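(* Let $c,b\ge2$ be integers, put $\alpha=\log_b c$, and suppose that $q\alpha-p=\varepsilon>0$ with $q\in\mathbb Z_{\ge1}$, $p\in\mathbb Z$. Define $\varrho=c^q/b^p=b^\varepsilon>1$, $M=\lfloor q/(\varrho-1)\rfloor$, assume $M\ge1$, and let $$J_{\max}=\max\left\{J\ge1:\varrho^{J-1}(M+q)<M+Jq+1\right\}.$$ Put $\gamma=\log\varrho$, $B=M+q$, $A=M+q+1$, and define $$\kappa=-\frac1\gamma W_{-1}\left(-\frac{\gamma B}{q}e^{-\gamma A/q}\right)-\frac Aq.$$ Then $\kappa>0$ and $$J_{\max}=\lceil\kappa\rceil.$$ If $k=J_{\max}-1$, then $$kq(qk+q-2)<2(M+1).$$ Consequently, $$J_{\max}<1+\frac{\sqrt{(q-2)^2+8(M+1)}-(q-2)}{2q}$$ and, more simply, $$J_{\max}<\frac{3+\sqrt{1+8(M+1)/q^2}}2<2+\frac{\sqrt{2(M+1)}}q.$$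
   Context: $\log$ is the natural logarithm. $W_{-1}$ is the real branch of the Lambert $W$ function (inverse of $w\mapsto we^w$) on $[-e^{-1},0)$ with values in $(-\infty,-1]$. *)

theory Defs
  imports Complex_Main
begin

(* The real branch W_{-1}.  Outside [-1/e, 0) the value is unspecified. *)
definition lambert_Wm1 :: "real \<Rightarrow> real" where
  "lambert_Wm1 = the_inv_into {..-1} (\<lambda>w. w * exp w)"

lemma bij_betw_lambert_Wm1_arg:
  "bij_betw (\<lambda>w::real. w * exp w) {..-1} {- exp (-1)..<0}"
proof -
  let ?f = "\<lambda>w::real. w * exp w"
  have dec: "?f v < ?f u" if "u < v" "v \<le> -1" for u v :: real
  proof (rule DERIV_neg_imp_decreasing_open[OF that(1)])
    fix x assume "u < x" "x < v"
    then have "x + 1 < 0" using that by simp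
    then have "(x + 1) * exp x < 0" by (simp add: mult_less_0_iff)
    moreover have "(?f has_real_derivative (x + 1) * exp x) (at x)"
      by (auto intro!: derivative_eq_intros simp: algebra_simps)
    ultimately show "\<exists>y. (?f has_real_derivative y) (at x) \<and> y < 0" by blast
  qed (auto intro!: continuous_intros)
  have inj: "inj_on ?f {..-1}"
    by (rule linorder_inj_onI) (use dec in force)+
  have "?f w \<in> {- exp (-1)..<0}" if "w \<le> -1" for w :: real
    using dec[of w "-1"] that by (cases "w = -1") (auto simp: mult_less_0_iff)
  moreover have "x \<in> ?f ` {..-1}" if x: "- exp (-1) \<le> x" "x < 0" for x :: real
  proof -
    define t where "t = max 1 (2 / (- x))"
    have t: "t \<ge> 1" "t \<ge> 2 / (- x)" by (auto simp: t_def)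
    have "t\<^sup>2 / 2 \<le> exp t" using exp_lower_Taylor_quadratic[of t] t by simp
    moreover have "2 * t \<le> (- x) * t * t"
    proof -
      have "2 \<le> (- x) * t" using t(2) x(2) by (simp add: field_simps)
      then show ?thesis using t(1) by (intro mult_right_mono) auto
    qed
    moreover have "(- x) * (t\<^sup>2 / 2) \<le> (- x) * exp t"
      using calculation(1) x(2) by (intro mult_left_mono) auto
    ultimately have "t \<le> (- x) * exp t" by (simp add: power2_eq_square)
    then have "x \<le> ?f (- t)" by (simp add: exp_minus field_simps)
    moreover have "?f (-1) \<le> x" using x by simp
    ultimately have "\<exists>w\<ge>- t. w \<le> -1 \<and> ?f w = x"
      using t(1) by (intro IVT2') (auto intro!: continuous_intros)
    then show ?thesis by auto
  qed
  ultimately have "?f ` {..-1} = {- exp (-1)..<0}" by fastforce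
  with inj show ?thesis by (simp add: bij_betw_def)
qed

end

theory Submission
  imports Defs
begin

text \<open>
  Write \<open>k = J - 1\<close>.  Since \<open>\<rho> = exp \<gamma>\<close>, membership of \<open>J\<close> in \<open>S\<close> says that the exponential
  \<open>B exp (\<gamma> k)\<close> lies strictly below the line \<open>A + q k\<close>.  At \<open>0\<close> it does, because \<open>B = A - 1\<close>; as
  the exponential is convex and eventually wins, it stays below the line exactly up to the unique
  positive crossing point.  Substituting \<open>w = - \<gamma> (x + A / q)\<close> turns the crossing equation into
  \<open>w exp w = - (\<gamma> B / q) exp (- \<gamma> A / q)\<close>.  At the later of the two crossings the exponential is
  steeper than the line, which is the condition \<open>w \<le> -1\<close> and so selects the branch \<open>W\<^bsub>-1\<^esub>\<close>;
  hence the positive crossing point is \<open>\<kappa>\<close> (lemma \<open>exp_below_line_iff\<close>).  The members of \<open>S\<close> are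
  therefore the \<open>J \<ge> 1\<close> with \<open>J - 1 < \<kappa>\<close>, and the largest of them is \<open>\<lceil>\<kappa>\<rceil>\<close>.

  The explicit bounds come from keeping only the terms up to second order of
  \<open>\<rho> ^ k = (1 + (\<rho> - 1)) ^ k\<close>.  The floor in the definition of \<open>M\<close> gives \<open>\<rho> - 1 > q / (M + 1)\<close>;
  inserting this, the first-order terms nearly cancel against the slope of the line and what is
  left is a quadratic inequality for \<open>k\<close> (lemma \<open>quadratic_bound_if_power_below_line\<close>).  Solving it,
  exactly or after weakening it, gives the three closed forms.
\<close>

lemma lambert_Wm1:
  assumes "x \<in> {- exp (-1)..<0}"
  shows "lambert_Wm1 x \<le> -1" "lambert_Wm1 x * exp (lambert_Wm1 x) = x"
proof -
  note bij = bij_betw_lambert_Wm1_arg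
  show "lambert_Wm1 x * exp (lambert_Wm1 x) = x"
    unfolding lambert_Wm1_def by (rule f_the_inv_into_f_bij_betw[OF bij]) (use assms in auto)
  have "lambert_Wm1 x \<in> {..-1}"
    unfolding lambert_Wm1_def
    using bij assms by (intro the_inv_into_into) (auto simp: bij_betw_def)
  then show "lambert_Wm1 x \<le> -1" by simp
qed

lemma mult_exp_minus_le:
  fixes s :: real
  shows "s * exp (- s) \<le> exp (-1)"
proof -
  have "s \<le> exp (s - 1)" using exp_ge_add_one_self[of "s - 1"] by simp
  then have "s * exp (- s) \<le> exp (s - 1) * exp (- s)" by (intro mult_right_mono) auto
  also have "\<dots> = exp (-1)" by (simp flip: exp_add)
  finally show ?thesis .
qed

lemma mult_exp_minus_antimono:
  fixes v s :: real
  assumes "1 \<le> v" "v \<le> s"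
  shows "s * exp (- s) \<le> v * exp (- v)"
proof -
  have "s - v \<le> v * (s - v)" using assms by (simp add: mult_le_cancel_right1)
  then have "s \<le> v * (1 + (s - v))" by (simp add: algebra_simps)
  also have "\<dots> \<le> v * exp (s - v)" using assms exp_ge_add_one_self[of "s - v"] by simp
  finally have "s * exp (- s) \<le> v * exp (s - v) * exp (- s)" by (intro mult_right_mono) auto
  also have "\<dots> = v * exp (- v)" by (simp add: mult.assoc flip: exp_add)
  finally show ?thesis .
qed

text \<open>
  The graph of \<open>exp\<close> lies above its tangent at \<open>t * y\<close>, both at \<open>0\<close> and at \<open>y\<close>; the mean of
  these two estimates with weights \<open>1 - t\<close> and \<open>t\<close> has the chord on one side and, on the other,
  only the value at the point of tangency.
\<close>

lemma exp_le_chord: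
  fixes t y :: real
  assumes "0 \<le> t" "t \<le> 1"
  shows "exp (t * y) \<le> (1 - t) + t * exp y"
proof -
  have tangent: "exp (t * y) * (1 + (z - t * y)) \<le> exp z" for z
  proof -
    have "exp (t * y) * (1 + (z - t * y)) \<le> exp (t * y) * exp (z - t * y)"
      by (intro mult_left_mono exp_ge_add_one_self) simp
    then show ?thesis by (simp flip: exp_add)
  qed
  have "(1 - t) * (exp (t * y) * (1 + (0 - t * y))) + t * (exp (t * y) * (1 + (y - t * y)))
      \<le> (1 - t) * exp 0 + t * exp y"
    using assms by (intro add_mono mult_left_mono tangent) auto
  then show ?thesis by (simp add: algebra_simps)
qed

text \<open>
  The substitution \<open>w = - \<gamma> (\<kappa> + A / q)\<close> makes \<open>\<kappa>\<close> a crossing point.  With \<open>s = \<gamma> A / q\<close> the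
  argument of \<open>W\<^bsub>-1\<^esub>\<close> is \<open>- (B / A) s exp (- s)\<close>; the factor \<open>B / A < 1\<close> puts it in the domain and,
  because \<open>s exp (- s)\<close> decreases beyond \<open>1\<close>, forces \<open>- w > s\<close>, that is \<open>\<kappa> > 0\<close>.  On the left of
  \<open>\<kappa>\<close> the comparison is convexity; on the right the tangent of the exponential at \<open>\<kappa>\<close>, whose
  slope is \<open>- w q \<ge> q\<close>, already stays above the line.
\<close>

lemma exp_below_line_iff:
  fixes \<gamma> q A B \<kappa> :: real
  assumes "\<gamma> > 0" "q > 0" "B > 0" "B < A"
  defines "a \<equiv> - (\<gamma> * B / q) * exp (- \<gamma> * A / q)"
  defines "\<kappa> \<equiv> - (1 / \<gamma>) * lambert_Wm1 a - A / q"
  shows "a \<in> {- exp (-1)..<0}" and "\<kappa> > 0"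
    and "\<And>x. x \<ge> 0 \<Longrightarrow> B * exp (\<gamma> * x) < A + q * x \<longleftrightarrow> x < \<kappa>"
proof -
  define s where "s = \<gamma> * A / q"
  define v where "v = - lambert_Wm1 a"
  have "s > 0" using assms by (simp add: s_def)
  have a_neg: "a < 0" using assms by (simp add: a_def mult_neg_pos)
  have a_gt: "- (s * exp (- s)) < a"
  proof -
    have "\<gamma> * B / q < s" unfolding s_def
      using assms by (intro divide_strict_right_mono mult_strict_left_mono) auto
    then have "\<gamma> * B / q * exp (- s) < s * exp (- s)" by (rule mult_strict_right_mono) simp
    then show ?thesis by (simp add: a_def s_def)
  qed
  show a: "a \<in> {- exp (-1)..<0}" using a_neg a_gt mult_exp_minus_le[of s] by simp
  have v1: "v \<ge> 1" and v: "v * exp (- v) = - a"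
    using lambert_Wm1[OF a] by (auto simp: v_def)
  have "\<not> v \<le> s" using mult_exp_minus_antimono[OF v1, of s] a_gt v by linarith
  moreover have \<kappa>: "\<gamma> * \<kappa> = v - s" "q * v = \<gamma> * (A + q * \<kappa>)"
    using assms(1,2) by (auto simp: \<kappa>_def v_def s_def field_simps)
  ultimately show \<kappa>_pos: "\<kappa> > 0"
    using assms(1) by (metis diff_gt_0_iff_gt not_le zero_less_mult_pos)
  have crossing: "B * exp (\<gamma> * \<kappa>) = A + q * \<kappa>"
  proof -
    have "v * exp (- v) = \<gamma> * B / q * exp (- s)" using v by (simp add: a_def s_def)
    then have "q * v * (exp (- v) * exp v) = \<gamma> * B * (exp (- s) * exp v)"
      using assms(2) by (simp add: field_simps)
    then have "\<gamma> * (A + q * \<kappa>) = \<gamma> * (B * exp (\<gamma> * \<kappa>))"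
      using \<kappa> by (simp flip: exp_add)
    then show ?thesis using assms(1) by simp
  qed
  fix x :: real assume "x \<ge> 0"
  show "B * exp (\<gamma> * x) < A + q * x \<longleftrightarrow> x < \<kappa>"
  proof
    assume "x < \<kappa>"
    define t where "t = x / \<kappa>"
    have t: "0 \<le> t" "t < 1" "x = t * \<kappa>"
      using \<open>x \<ge> 0\<close> \<open>x < \<kappa>\<close> by (auto simp: t_def)
    have "B * exp (\<gamma> * x) \<le> B * ((1 - t) + t * exp (\<gamma> * \<kappa>))"
      using exp_le_chord[of t "\<gamma> * \<kappa>"] t assms(3) by (simp add: ac_simps)
    also have "\<dots> = (1 - t) * B + t * (B * exp (\<gamma> * \<kappa>))" by (simp add: algebra_simps)
    also have "\<dots> < (1 - t) * A + t * (B * exp (\<gamma> * \<kappa>))" using t assms(4) by simp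
    also have "\<dots> = A + q * x" unfolding crossing t(3) by (simp add: algebra_simps)
    finally show "B * exp (\<gamma> * x) < A + q * x" .
  next
    assume below: "B * exp (\<gamma> * x) < A + q * x"
    show "x < \<kappa>"
    proof (rule ccontr)
      assume "\<not> x < \<kappa>"
      then have "q * (x - \<kappa>) \<le> v * (q * (x - \<kappa>))"
        using v1 assms(2) mult_right_mono[of 1 v "q * (x - \<kappa>)"] by simp
      then have "A + q * x \<le> (A + q * \<kappa>) + v * (q * (x - \<kappa>))" by (simp add: algebra_simps)
      also have "\<dots> = (A + q * \<kappa>) + q * v * (x - \<kappa>)" by (simp add: ac_simps)
      also have "\<dots> = (A + q * \<kappa>) * (1 + \<gamma> * (x - \<kappa>))"
        unfolding \<kappa>(2) by (simp add: algebra_simps)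
      also have "\<dots> \<le> (A + q * \<kappa>) * exp (\<gamma> * (x - \<kappa>))"
        using assms \<kappa>_pos by (intro mult_left_mono exp_ge_add_one_self) auto
      also have "\<dots> = B * (exp (\<gamma> * \<kappa>) * exp (\<gamma> * (x - \<kappa>)))" by (simp flip: crossing)
      also have "\<dots> = B * exp (\<gamma> * x)" by (simp add: algebra_simps flip: exp_add)
      finally show False using below by simp
    qed
  qed
qed

lemma power_ge_second_order:
  fixes \<delta> :: real
  assumes "\<delta> \<ge> 0"
  shows "1 + real k * \<delta> + real k * (real k - 1) / 2 * \<delta>\<^sup>2 \<le> (1 + \<delta>) ^ k"
proof (induction k)
  case (Suc k)
  have "0 \<le> real k * (real k - 1)" by (cases k) auto
  then have "0 \<le> real k * (real k - 1) / 2 * \<delta> ^ 3" using assms by simp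
  then have "1 + real (Suc k) * \<delta> + real (Suc k) * (real (Suc k) - 1) / 2 * \<delta>\<^sup>2
      \<le> (1 + real k * \<delta> + real k * (real k - 1) / 2 * \<delta>\<^sup>2) * (1 + \<delta>)"
    by (simp add: field_simps power2_eq_square power3_eq_cube)
  also have "\<dots> \<le> (1 + \<delta>) ^ k * (1 + \<delta>)" using Suc assms by (intro mult_right_mono) auto
  finally show ?case by (simp add: ac_simps)
qed simp

text \<open>
  Here \<open>m\<close> stands for \<open>M + 1\<close>.  As \<open>1 + \<delta> \<ge> 1 + q / m\<close>, it suffices to expand at \<open>q / m\<close>.  After
  multiplication by \<open>m - 1 + q\<close> the first-order term exceeds \<open>k q\<close> by \<open>k q (q - 1) / m\<close>, and the
  second-order term is at least \<open>k (k - 1) q\<^sup>2 / (2 m)\<close> because \<open>q \<ge> 1\<close>.  Together they have to stay below \<open>1\<close>.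
\<close>

lemma quadratic_bound_if_power_below_line:
  fixes \<delta> q m :: real
  assumes "m > 0" "q \<ge> 1" "q / m \<le> \<delta>"
    and below: "(1 + \<delta>) ^ k * (m - 1 + q) < m + q + real k * q"
  shows "real k * q * (q * real k + q - 2) < 2 * m"
proof -
  define d where "d = q / m"
  have d: "0 \<le> d" "m * d = q" using assms by (auto simp: d_def)
  have kk: "0 \<le> real k * (real k - 1)" by (cases k) auto
  have "m * ((1 + real k * d + real k * (real k - 1) / 2 * d\<^sup>2) * (m - 1 + q))
      = m * (m - 1 + q) + real k * (m * d) * (m - 1 + q)
        + real k * (real k - 1) / 2 * (m * d) * (m * d + d * (q - 1))"
    by (simp add: algebra_simps power2_eq_square)
  also have "\<dots> \<ge> m * (m - 1 + q) + real k * q * (m - 1 + q) + real k * (real k - 1) / 2 * q * q"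
    unfolding d(2) using kk d(1) assms by (intro add_left_mono mult_left_mono) auto
  finally have "m * (m - 1 + q) + real k * q * (m - 1 + q) + real k * (real k - 1) / 2 * q * q
      \<le> m * ((1 + real k * d + real k * (real k - 1) / 2 * d\<^sup>2) * (m - 1 + q))" .
  also have "\<dots> \<le> m * ((1 + d) ^ k * (m - 1 + q))"
    using assms power_ge_second_order[OF d(1), of k] by (intro mult_left_mono mult_right_mono) auto
  also have "\<dots> \<le> m * ((1 + \<delta>) ^ k * (m - 1 + q))"
    using assms d(1) by (intro mult_left_mono mult_right_mono power_mono) (auto simp: d_def)
  also have "\<dots> < m * (m + q + real k * q)" using below assms by simp
  finally show ?thesis by (simp add: field_simps)
qed

text \<open>
  The first bound solves the quadratic inequality exactly.  The second replaces \<open>q - 2\<close> by the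
  smaller \<open>- q\<close>, so that \<open>k (k - 1) q\<^sup>2 < 2 m\<close> remains, and completes the square.
\<close>

lemma sqrt_bounds_if_quadratic_bound:
  fixes k q m :: real
  assumes "k \<ge> 0" "q \<ge> 1" "m > 0" and quad: "k * q * (q * k + q - 2) < 2 * m"
  shows "k < (sqrt ((q - 2)\<^sup>2 + 8 * m) - (q - 2)) / (2 * q)"
    and "k < (1 + sqrt (1 + 8 * m / q\<^sup>2)) / 2"
    and "(1 + sqrt (1 + 8 * m / q\<^sup>2)) / 2 < 1 + sqrt (2 * m) / q"
proof -
  have "(2 * (k * q) + (q - 2))\<^sup>2 < (q - 2)\<^sup>2 + 8 * m"
    using quad by (simp add: algebra_simps power2_eq_square)
  then have "2 * (k * q) + (q - 2) < sqrt ((q - 2)\<^sup>2 + 8 * m)" by (rule real_less_rsqrt)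
  then show "k < (sqrt ((q - 2)\<^sup>2 + 8 * m) - (q - 2)) / (2 * q)"
    using assms(2) by (simp add: field_simps)
next
  have "k * q * (q * k - q) \<le> k * q * (q * k + q - 2)"
    using assms by (intro mult_left_mono) auto
  then have "k * (k - 1) * q\<^sup>2 < 2 * m" using quad by (simp add: algebra_simps power2_eq_square)
  then have "k * (k - 1) < 2 * m / q\<^sup>2" using assms(2) by (simp add: pos_less_divide_eq)
  moreover have "(2 * k - 1)\<^sup>2 = 1 + 4 * (k * (k - 1))"
    by (simp add: algebra_simps power2_eq_square)
  ultimately have "(2 * k - 1)\<^sup>2 < 1 + 8 * m / q\<^sup>2" by linarith
  then have "2 * k - 1 < sqrt (1 + 8 * m / q\<^sup>2)" by (rule real_less_rsqrt)
  then show "k < (1 + sqrt (1 + 8 * m / q\<^sup>2)) / 2" by simp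
next
  define r where "r = sqrt (2 * m) / q"
  have "r > 0" and "r\<^sup>2 = 2 * m / q\<^sup>2" using assms by (auto simp: r_def power_divide)
  then have "1 + 8 * m / q\<^sup>2 < (1 + 2 * r)\<^sup>2" by (simp add: power2_sum power_mult_distrib)
  then have "sqrt (1 + 8 * m / q\<^sup>2) < 1 + 2 * r" using \<open>r > 0\<close> by (intro real_less_lsqrt) auto
  then show "(1 + sqrt (1 + 8 * m / q\<^sup>2)) / 2 < 1 + sqrt (2 * m) / q" by (simp flip: r_def)
qed

lemma nat_minus_one_less_eq_atLeastAtMost_ceiling:
  fixes \<kappa> :: real
  assumes "\<kappa> > 0"
  shows "{J. J \<ge> 1 \<and> real (J - 1) < \<kappa>} = {1..nat \<lceil>\<kappa>\<rceil>}" and "1 \<le> nat \<lceil>\<kappa>\<rceil>"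
proof -
  show "1 \<le> nat \<lceil>\<kappa>\<rceil>" using assms by linarith
  have "real (J - 1) < \<kappa> \<longleftrightarrow> J \<le> nat \<lceil>\<kappa>\<rceil>" if "J \<ge> 1" for J
    using that by (simp add: of_nat_diff) linarith
  then show "{J. J \<ge> 1 \<and> real (J - 1) < \<kappa>} = {1..nat \<lceil>\<kappa>\<rceil>}" by auto
qed

theorem proposition5p28:
  fixes c b q Jmax :: nat and p M :: int
    and \<alpha> \<epsilon> \<rho> \<gamma> A B \<kappa> :: real
    and S :: "nat set"
  assumes "c \<ge> 2" and "b \<ge> 2" and "q \<ge> 1"
    and "\<alpha> = log (real b) (real c)"
    and "\<epsilon> = real q * \<alpha> - real_of_int p" and "\<epsilon> > 0"
    and "\<rho> = real c ^ q / real b powi p"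
    and "M = \<lfloor>real q / (\<rho> - 1)\<rfloor>" and "M \<ge> 1"
    and "S = {J. J \<ge> 1 \<and>
           \<rho> ^ (J - 1) * (real_of_int M + real q) < real_of_int M + real J * real q + 1}"
    and "Jmax = Max S"
    and "\<gamma> = ln \<rho>"
    and "B = real_of_int M + real q"
    and "A = real_of_int M + real q + 1"
    and "\<kappa> = - (1 / \<gamma>) * lambert_Wm1 (- (\<gamma> * B / real q) * exp (- \<gamma> * A / real q)) - A / real q"
  shows "\<rho> = real b powr \<epsilon> \<and> \<rho> > 1
    \<and> finite S \<and> S \<noteq> {}
    \<and> - (\<gamma> * B / real q) * exp (- \<gamma> * A / real q) \<in> {- exp (-1)..<0}
    \<and> \<kappa> > 0
    \<and> int Jmax = \<lceil>\<kappa>\<rceil>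
    \<and> (\<forall>k::int. k = int Jmax - 1 \<longrightarrow>
          k * int q * (int q * k + int q - 2) < 2 * (M + 1))
    \<and> real Jmax < 1 + (sqrt ((real q - 2)\<^sup>2 + 8 * (real_of_int M + 1)) - (real q - 2)) / (2 * real q)
    \<and> real Jmax < (3 + sqrt (1 + 8 * (real_of_int M + 1) / (real q)\<^sup>2)) / 2
    \<and> (3 + sqrt (1 + 8 * (real_of_int M + 1) / (real q)\<^sup>2)) / 2
        < 2 + sqrt (2 * (real_of_int M + 1)) / real q"
proof -
  have q: "real q \<ge> 1" and b: "real b > 1" and c: "real c > 0" using assms(1-3) by auto
  have M: "real_of_int M \<ge> 1" using assms(9) by simp
  have \<rho>: "\<rho> = real b powr \<epsilon>"
  proof -
    have "real b powr \<epsilon> = (real b powr \<alpha>) powr real q / real b powr real_of_int p"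
      by (simp add: assms(5) powr_diff powr_powr mult.commute)
    also have "real b powr \<alpha> = real c" using b c assms(4) by simp
    also have "real c powr real q = real c ^ q" using c by (simp add: powr_realpow)
    also have "real b powr real_of_int p = real b powi p" using b by (simp add: powr_real_of_int')
    finally show ?thesis using assms(7) by simp
  qed
  then have \<rho>1: "\<rho> > 1" using b assms(6) by simp
  have \<gamma>: "\<gamma> > 0" using \<rho>1 assms(12) by simp
  have BA: "B > 0" "B < A" using M q assms(13,14) by auto
  have q0: "real q > 0" using q by linarith
  note line = exp_below_line_iff[OF \<gamma> q0 BA, folded assms(15)]

  have "\<rho> ^ (J - 1) * (real_of_int M + real q) < real_of_int M + real J * real q + 1
      \<longleftrightarrow> real (J - 1) < \<kappa>" if "J \<ge> 1" for J
  proof -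
    have "\<rho> ^ (J - 1) = exp (\<gamma> * real (J - 1))"
      using \<rho>1 by (simp add: assms(12) exp_of_nat2_mult)
    moreover have "real_of_int M + real J * real q + 1 = A + real q * real (J - 1)"
      using that by (simp add: assms(14) of_nat_diff algebra_simps)
    ultimately show ?thesis using line(3)[of "real (J - 1)"] assms(13) by (simp add: mult.commute)
  qed
  then have "S = {J. J \<ge> 1 \<and> real (J - 1) < \<kappa>}" unfolding assms(10) by blast
  then have S: "S = {1..nat \<lceil>\<kappa>\<rceil>}" and n1: "1 \<le> nat \<lceil>\<kappa>\<rceil>"
    using nat_minus_one_less_eq_atLeastAtMost_ceiling[OF line(2)] by auto
  then have J: "Jmax = nat \<lceil>\<kappa>\<rceil>" unfolding assms(11)
    by (intro Max_eqI) auto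
  then have Jceil: "int Jmax = \<lceil>\<kappa>\<rceil>" using line(2) by simp

  define k where "k = Jmax - 1"
  define m where "m = real_of_int M + 1"
  have Jk: "Jmax = k + 1" using J n1 by (simp add: k_def)
  have "real q / (\<rho> - 1) < m" unfolding m_def assms(8) by linarith
  then have "real q / m \<le> \<rho> - 1" using \<rho>1 M by (simp add: m_def field_simps)
  moreover have "Jmax \<in> S" using S J n1 by simp
  then have "(1 + (\<rho> - 1)) ^ k * (m - 1 + real q) < m + real q + real k * real q"
    unfolding assms(10) by (simp add: Jk m_def algebra_simps)
  ultimately have quad: "real k * real q * (real q * real k + real q - 2) < 2 * m"
    using M q by (intro quadratic_bound_if_power_below_line) (auto simp: m_def)
  have "int k * int q * (int q * int k + int q - 2) < 2 * (M + 1)"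
    using quad unfolding m_def
    by (subst of_int_less_iff[where 'a = real, symmetric]) simp
  then have quad_int: "\<forall>k::int. k = int Jmax - 1 \<longrightarrow>
      k * int q * (int q * k + int q - 2) < 2 * (M + 1)"
    by (simp add: Jk)
  have m: "m > 0" using M by (simp add: m_def)
  note bounds = sqrt_bounds_if_quadratic_bound[OF of_nat_0_le_iff q m quad]
  have "real Jmax < 1 + (sqrt ((real q - 2)\<^sup>2 + 8 * m) - (real q - 2)) / (2 * real q)"
    "real Jmax < (3 + sqrt (1 + 8 * m / (real q)\<^sup>2)) / 2"
    "(3 + sqrt (1 + 8 * m / (real q)\<^sup>2)) / 2 < 2 + sqrt (2 * m) / real q"
    using bounds by (auto simp: Jk add_divide_distrib)
  then show ?thesis
    using \<rho> \<rho>1 S n1 line(1,2) Jceil quad_int unfolding m_def by auto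
qed

end
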